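(* Let $q$ be a power of an odd prime with $q\equiv3\pmod4$, let $d=4k+2$ with $k$ a positive integer, let $S_0=\{x\in\mathbb F_q^d: x_1^2+\cdots+x_d^2=0\}$, $A\subset S_0$ and $B\subset\mathbb F_q^d$. If $|A||B|\ge16q^d$ and either $|A|\le q^{(d-1)/2}$ or $|A|\ge q^{d/2}$, then $|\Delta(A,B)|\ge q/144$.
   Context: $\|x-y\|=\sum_{i}(x_i-y_i)^2$ and $\Delta(A,B)=\{\|a-b\|:a\in A,b\in B\}$. *)

theory Defs
  imports "HOL-Analysis.Analysis" "HOL-Computational_Algebra.Primes"
begin

definition qnorm :: "('a::comm_ring_1) ^ 'n \<Rightarrow> 'a" where
  "qnorm x = (\<Sum>i\<in>UNIV. (x $ i) ^ 2)"

definition dist_set :: "(('a::comm_ring_1) ^ 'n) set \<Rightarrow> ('a ^ 'n) set \<Rightarrow> 'a set" where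
  "dist_set A B = {qnorm (a - b) | a b. a \<in> A \<and> b \<in> B}"

definition sphere0 :: "(('a::comm_ring_1) ^ 'n) set" where
  "sphere0 = {x. qnorm x = 0}"

end

theory Submission
  imports Defs
begin

text \<open>
  Fix a nontrivial additive character \<open>\<psi>\<close> and write \<open>CARD('n) = 2 * h\<close> with \<open>h\<close> odd. The number of
  distances is controlled by the \<open>L\<^sup>2\<close> norm of \<open>s \<mapsto> \<Sum>a\<in>A. \<Sum>b\<in>B. \<psi> (s * qnorm (a - b))\<close> over
  \<open>s \<noteq> 0\<close>. As \<open>q \<equiv> 3 (mod 4)\<close> and \<open>h\<close> is odd, the \<open>CARD('n)\<close>-th power of the quadratic Gauss sum
  is \<open>- (q ^ h)\<close>; hence the Fourier transform of the cone is negative at nonzero isotropic vectors,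
  and these contribute with a favourable sign to upper bounds for second moments over the cone.

  If \<open>card A \<ge> q ^ h\<close>, apply Cauchy--Schwarz in \<open>a\<close>, complete the sum to the whole cone and use such
  a second moment. If \<open>card A \<le> q ^ h\<close>, pass to the Fourier side, group the frequencies by their norm
  and bound the energy of the transform of \<open>A\<close> on every sphere. On a sphere of nonzero radius this
  energy is an average of Kloosterman sums over \<open>A \<times> A\<close>. No Weil bound is needed: a further second
  moment over the cone produces only sums \<open>\<Sum>v\<noteq>0. \<psi> (r * (c - 1) * v)\<close> over collinear pairs \<open>a = c b\<close>,
  and these are \<open>-1\<close> unless \<open>c = 1\<close>.
\<close>

section \<open>Additive characters\<close>

lemma finite_field_fermat:
  fixes x :: "'a::{field,finite}"
  assumes "x \<noteq> 0"
  shows "x ^ (CARD('a) - 1) = 1"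
proof -
  have bij: "bij_betw ((*) x) (UNIV - {0}) (UNIV - {0})"
    by (rule bij_betwI[where g = "\<lambda>y. y / x"]) (use assms in auto)
  have "(\<Prod>y\<in>UNIV - {0}. y) = (\<Prod>y\<in>UNIV - {0}. x * y)"
    using prod.reindex_bij_betw[OF bij, of "\<lambda>y. y"] by simp
  also have "\<dots> = x ^ (CARD('a) - 1) * (\<Prod>y\<in>UNIV - {0}. y)"
    by (simp add: prod.distrib card_Diff_singleton)
  finally show ?thesis
    by (simp add: prod_zero_iff)
qed

lemma of_nat_card_field: "of_nat CARD('a) = (0 :: 'a::{field,finite})"
proof -
  have bij: "bij_betw ((+) (1::'a)) UNIV UNIV"
    by (rule bij_betwI[where g = "\<lambda>y. y - 1"]) auto
  have "(\<Sum>y\<in>UNIV. y) = (\<Sum>y\<in>UNIV. (1::'a) + y)"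
    using sum.reindex_bij_betw[OF bij, of "\<lambda>y. y"] by simp
  thus ?thesis by (simp add: sum.distrib)
qed

text \<open>Distributivity, reading vectors as choice functions; it splits character sums over the
  space into one-variable sums.\<close>

lemma sum_vec_prod:
  fixes f :: "'n::finite \<Rightarrow> 'a::finite \<Rightarrow> 'b::comm_semiring_1"
  shows "(\<Sum>x\<in>UNIV. \<Prod>i\<in>UNIV. f i (x $ i)) = (\<Prod>i\<in>UNIV. \<Sum>y\<in>UNIV. f i y)"
proof -
  have "(\<Prod>i\<in>UNIV. \<Sum>y\<in>UNIV. f i y) = (\<Sum>g\<in>UNIV. \<Prod>i\<in>UNIV. f i (g i))"
    by (subst prod_sum_PiE) auto
  also have "\<dots> = (\<Sum>x\<in>UNIV. \<Prod>i\<in>UNIV. f i (x $ i))"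
    by (rule sum.reindex_bij_witness[of _ "\<lambda>x i. x $ i" "\<lambda>g. \<chi> i. g i"]) auto
  finally show ?thesis ..
qed

lemma of_real_of_bool [simp]: "of_real (of_bool P) = (of_bool P :: 'b::real_algebra_1)"
  by (cases P) auto

lemma cmod_sum_mult_squared_le:
  fixes f g :: "'b \<Rightarrow> complex"
  shows "(cmod (\<Sum>i\<in>I. f i * g i))\<^sup>2 \<le> (\<Sum>i\<in>I. (cmod (f i))\<^sup>2) * (\<Sum>i\<in>I. (cmod (g i))\<^sup>2)"
proof -
  have "cmod (\<Sum>i\<in>I. f i * g i) \<le> (\<Sum>i\<in>I. cmod (f i) * cmod (g i))"
    using norm_sum[of "\<lambda>i. f i * g i" I] by (simp add: norm_mult)
  hence "(cmod (\<Sum>i\<in>I. f i * g i))\<^sup>2 \<le> (\<Sum>i\<in>I. cmod (f i) * cmod (g i))\<^sup>2"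
    by (intro power_mono) auto
  also have "\<dots> \<le> (\<Sum>i\<in>I. (cmod (f i))\<^sup>2) * (\<Sum>i\<in>I. (cmod (g i))\<^sup>2)"
    by (rule Cauchy_Schwarz_ineq_sum)
  finally show ?thesis .
qed

lemma cmod_sum_squared_le:
  fixes f :: "'b \<Rightarrow> complex"
  shows "(cmod (\<Sum>i\<in>I. f i))\<^sup>2 \<le> real (card I) * (\<Sum>i\<in>I. (cmod (f i))\<^sup>2)"
  using cmod_sum_mult_squared_le[of "\<lambda>_. 1" f I] by simp

lemma cmod_sum_squared_eq:
  fixes f :: "'b \<Rightarrow> complex"
  shows "of_real ((cmod (\<Sum>i\<in>I. f i))\<^sup>2) = (\<Sum>i\<in>I. \<Sum>j\<in>I. f i * cnj (f j))"
  unfolding complex_norm_square by (simp add: sum_product)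

definition dot :: "'a::comm_ring_1 ^ 'n \<Rightarrow> 'a ^ 'n \<Rightarrow> 'a" where
  "dot x y = (\<Sum>i\<in>UNIV. x $ i * y $ i)"

lemma dot_commute: "dot x y = dot y x"
  by (simp add: dot_def mult.commute)

lemma dot_diff_right: "dot x (y - z) = dot x y - dot x z"
  by (simp add: dot_def right_diff_distrib sum_subtractf)

lemma dot_scale_right: "dot x (c *s y) = c * dot x y"
  by (simp add: dot_def sum_distrib_left mult_ac)

lemma qnorm_diff: "qnorm (x - y) = qnorm x + qnorm y - 2 * dot x y"
  unfolding qnorm_def dot_def
  by (simp add: power2_diff sum.distrib sum_subtractf sum_distrib_left mult_ac)

lemma qnorm_scale: "qnorm (c *s x) = c\<^sup>2 * qnorm x"
  by (simp add: qnorm_def power_mult_distrib sum_distrib_left)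

section \<open>Orthogonality and Parseval for one nontrivial character\<close>

locale additive_character =
  fixes \<psi> :: "'a::{field,finite} \<Rightarrow> complex"
  assumes add: "\<psi> (x + y) = \<psi> x * \<psi> y"
    and norm_1 [simp]: "cmod (\<psi> x) = 1"
    and nontrivial: "\<exists>x. \<psi> x \<noteq> 1"
begin

lemma neq_0 [simp]: "\<psi> x \<noteq> 0"
  using norm_1[of x] by (metis norm_zero zero_neq_one)

lemma zero [simp]: "\<psi> 0 = 1"
  using add[of 0 0] by simp

lemma cnj_eq: "cnj (\<psi> x) = \<psi> (- x)"
proof -
  have "\<psi> x * cnj (\<psi> x) = \<psi> x * \<psi> (- x)"
    using add[of x "- x"] complex_norm_square[of "\<psi> x"] by simp
  thus ?thesis by simp
qed

lemma diff: "\<psi> (x - y) = \<psi> x * cnj (\<psi> y)"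
  using add[of x "- y"] by (simp add: cnj_eq)

lemma sum_arg: "\<psi> (sum f I) = (\<Prod>i\<in>I. \<psi> (f i))"
  by (induction I rule: infinite_finite_induct) (auto simp: add)

text \<open>For \<open>c\<close> nonzero, translating the variable by \<open>y / c\<close>
  multiplies the sum by a value \<open>\<psi> y\<close> other than 1, so the sum vanishes.\<close>

lemma orthogonality: "(\<Sum>x\<in>UNIV. \<psi> (c * x)) = (if c = 0 then of_nat CARD('a) else 0)"
proof (cases "c = 0")
  case False
  obtain y where y: "\<psi> y \<noteq> 1" using nontrivial by blast
  have bij: "bij_betw (\<lambda>x. y / c + x) UNIV UNIV"
    by (rule bij_betwI[where g = "\<lambda>x. x - y / c"]) auto
  have "(\<Sum>x\<in>UNIV. \<psi> (c * x)) = (\<Sum>x\<in>UNIV. \<psi> (c * (y / c + x)))"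
    using sum.reindex_bij_betw[OF bij, of "\<lambda>x. \<psi> (c * x)"] by simp
  also have "\<dots> = \<psi> y * (\<Sum>x\<in>UNIV. \<psi> (c * x))"
    using False by (simp add: distrib_left add sum_distrib_left)
  finally show ?thesis using y False by simp
qed simp

lemma orthogonality_nz:
  "(\<Sum>x\<in>UNIV - {0}. \<psi> (c * x)) = (if c = 0 then of_nat CARD('a) else 0) - 1"
  using orthogonality[of c] by (simp add: sum_diff1)

lemma orthogonality_dot:
  "(\<Sum>x\<in>UNIV. \<psi> (dot x (y :: 'a ^ 'n))) = (if y = 0 then of_nat CARD('a) ^ CARD('n) else 0)"
proof -
  have "(\<Sum>x\<in>UNIV. \<psi> (dot x y)) = (\<Sum>x\<in>UNIV. \<Prod>i\<in>UNIV. \<psi> (y $ i * x $ i))"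
    by (simp add: dot_def sum_arg mult.commute)
  also have "\<dots> = (\<Prod>i\<in>UNIV. \<Sum>z\<in>UNIV. \<psi> (y $ i * z))"
    by (rule sum_vec_prod)
  also have "\<dots> = (if y = 0 then of_nat CARD('a) ^ CARD('n) else 0)"
    by (auto simp: orthogonality vec_eq_iff)
  finally show ?thesis .
qed

text \<open>After expanding the square, orthogonality in \<open>u\<close> leaves only the diagonal
  \<open>r = r'\<close>.\<close>

lemma parseval:
  fixes f :: "'a \<Rightarrow> complex"
  shows "(\<Sum>u\<in>UNIV. (cmod (\<Sum>r\<in>UNIV. f r * \<psi> (u * r)))\<^sup>2) = real CARD('a) * (\<Sum>r\<in>UNIV. (cmod (f r))\<^sup>2)"
proof -
  have "complex_of_real (\<Sum>u\<in>UNIV. (cmod (\<Sum>r\<in>UNIV. f r * \<psi> (u * r)))\<^sup>2)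
      = (\<Sum>u\<in>UNIV. \<Sum>r\<in>UNIV. \<Sum>r'\<in>UNIV. f r * cnj (f r') * \<psi> ((r - r') * u))"
    unfolding of_real_sum cmod_sum_squared_eq
    by (simp add: diff algebra_simps)
  also have "\<dots> = (\<Sum>r\<in>UNIV. \<Sum>r'\<in>UNIV. \<Sum>u\<in>UNIV. f r * cnj (f r') * \<psi> ((r - r') * u))"
    by (subst sum.swap, intro sum.cong refl sum.swap)
  also have "\<dots> = (\<Sum>r\<in>UNIV. \<Sum>r'\<in>UNIV. f r * cnj (f r') * (if r = r' then of_nat CARD('a) else 0))"
    by (simp flip: sum_distrib_left add: orthogonality)
  also have "\<dots> = (\<Sum>r\<in>UNIV. f r * cnj (f r) * of_nat CARD('a))"
    by (intro sum.cong refl) (simp add: if_distrib[of "(*) _"] cong: if_cong)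
  also have "\<dots> = complex_of_real (CARD('a) * (\<Sum>r\<in>UNIV. (cmod (f r))\<^sup>2))"
    by (simp add: complex_norm_square sum_distrib_left mult_ac flip: of_real_power)
  finally show ?thesis by (simp only: of_real_eq_iff)
qed

lemma parseval_dot:
  fixes B :: "('a ^ 'n) set"
  shows "(\<Sum>m\<in>UNIV. (cmod (\<Sum>b\<in>B. \<psi> (dot m b)))\<^sup>2) 
    = real CARD('a) ^ CARD('n) * real (card B)"
proof -
  have "complex_of_real (\<Sum>m\<in>UNIV. (cmod (\<Sum>b\<in>B. \<psi> (dot m b)))\<^sup>2)
      = (\<Sum>m\<in>UNIV. \<Sum>b\<in>B. \<Sum>b'\<in>B. \<psi> (dot m (b - b')))"
    unfolding of_real_sum cmod_sum_squared_eq by (simp add: diff dot_diff_right)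
  also have "\<dots> = (\<Sum>b\<in>B. \<Sum>b'\<in>B. \<Sum>m\<in>UNIV. \<psi> (dot m (b - b')))"
    by (subst sum.swap, intro sum.cong refl sum.swap)
  also have "\<dots> = of_nat CARD('a) ^ CARD('n) * of_nat (card B)"
    by (simp add: orthogonality_dot mult.commute)
  also have "\<dots> = complex_of_real (real CARD('a) ^ CARD('n) * real (card B))"
    by simp
  finally show ?thesis by (simp only: of_real_eq_iff)
qed

end

text \<open>A maximal additive subgroup \<open>H\<close> avoiding \<open>1\<close> is a complement of the prime field.\<close>

lemma additive_character_exists:
  "\<exists>\<psi> :: 'a::{field,finite} \<Rightarrow> complex. additive_character \<psi>"
proof -
  define p where "p = CHAR('a)"
  have p: "prime p"
    unfolding p_def by (simp add: prime_CHAR_semidom finite_imp_CHAR_pos)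
  have p0: "of_nat p = (0::'a)"
    by (simp add: p_def)
  \<comment> \<open>Such sets are subgroups, since \<open>- x\<close> is the
    \<open>(p - 1)\<close>-fold sum of \<open>x\<close>.\<close>
  define sub where "sub H \<longleftrightarrow> (0::'a) \<in> H \<and> (\<forall>x\<in>H. \<forall>y\<in>H. x + y \<in> H)" for H
  define C where "C = {H. sub H \<and> 1 \<notin> H}"
  have "{0} \<in> C" by (auto simp: C_def sub_def)
  then obtain H where H: "H \<in> C" and max: "\<And>K. K \<in> C \<Longrightarrow> H \<subseteq> K \<Longrightarrow> H = K"
    using finite_has_maximal[of C] by auto
  have H0: "0 \<in> H" and Hadd: "\<And>x y. x \<in> H \<Longrightarrow> y \<in> H \<Longrightarrow> x + y \<in> H" and H1: "1 \<notin> H"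
    using H by (auto simp: C_def sub_def)
  have Hmul: "of_nat n * x \<in> H" if "x \<in> H" for n x
    by (induction n) (auto simp: H0 Hadd that algebra_simps)
  have inv: "\<exists>i. of_nat i * of_nat j = (1::'a)" if "\<not> p dvd j" for j
  proof -
    have "gcd j p = 1"
      using p that by (metis coprime_iff_gcd_eq_1 coprime_commute prime_imp_coprime)
    moreover have "j \<noteq> 0" using that by (metis dvd_0_right)
    ultimately obtain i l where "j * i = p * l + 1"
      using bezout_nat[of j p] by auto
    hence "(of_nat (j * i) :: 'a) = of_nat (p * l + 1)" by (simp only:)
    thus ?thesis by (intro exI[of _ i]) (simp add: p0 mult.commute)
  qed
  \<comment> \<open>Otherwise a multiple of \<open>of_nat j\<close> by an inverse modulo
    \<open>p\<close> would put 1 into \<open>H\<close>.\<close>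
  have dvdI: "p dvd j" if "of_nat j \<in> H" for j
    using inv[of j] Hmul[OF that] H1 by metis
  have uminus: "- x = of_nat (p - 1) * x" for x :: 'a
    using prime_gt_0_nat[OF p] p0 by (simp add: of_nat_diff)
  have Hdiff: "x - y \<in> H" if "x \<in> H" "y \<in> H" for x y
    using Hadd[OF that(1) Hmul[OF that(2), of "p - 1"]] uminus[of y] by (metis diff_conv_add_uminus)
  \<comment> \<open>By maximality, adjoining \<open>x\<close> to \<open>H\<close> must capture 1. In
    \<open>1 = y + of_nat n * x\<close> the factor \<open>n\<close> is invertible modulo
    \<open>p\<close>, and solving for \<open>x\<close> puts it in the prime field modulo
    \<open>H\<close>.\<close>
  have ex: "\<exists>j. x - of_nat j \<in> H" for x
  proof (cases "x \<in> H")
    case False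
    define K where "K = {y + of_nat n * x | y n. y \<in> H}"
    have "sub K"
      unfolding sub_def
    proof (intro conjI ballI)
      show "0 \<in> K" unfolding K_def using H0 by (force intro!: exI[of _ 0])
      fix u v assume "u \<in> K" "v \<in> K"
      then obtain y n z l where "u = y + of_nat n * x" "v = z + of_nat l * x" "y \<in> H" "z \<in> H"
        by (auto simp: K_def)
      thus "u + v \<in> K" unfolding K_def
        by (auto intro!: exI[of _ "y + z"] exI[of _ "n + l"] Hadd simp: algebra_simps)
    qed
    moreover have "H \<subseteq> K" unfolding K_def by (force intro: exI[of _ 0])
    moreover have "x \<in> K" unfolding K_def using H0 by (force intro: exI[of _ 1])
    ultimately have "1 \<in> K" using max[of K] False by (auto simp: C_def)
    then obtain y n where yn: "1 = y + of_nat n * x" "y \<in> H" by (auto simp: K_def)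
    have "\<not> p dvd n"
    proof
      assume "p dvd n"
      hence "(of_nat n :: 'a) = 0" using p0 by (auto elim: dvdE)
      thus False using yn H1 by simp
    qed
    then obtain i where i: "of_nat i * of_nat n = (1::'a)" using inv by blast
    have "of_nat i = of_nat i * y + x"
      using arg_cong[OF yn(1), of "\<lambda>z. of_nat i * z"] i by (simp add: distrib_left flip: mult.assoc)
    hence "x - of_nat i = 0 - of_nat i * y" by (simp add: algebra_simps)
    thus ?thesis using Hdiff[OF H0 Hmul[OF yn(2), of i]] by metis
  qed (auto intro: exI[of _ 0])
  \<comment> \<open>\<open>J x\<close> is determined only modulo \<open>p\<close>; as
    \<open>\<omega>\<close> is a \<open>p\<close>-th root of unity, the power
    \<open>\<omega> ^ J x\<close> does not depend on the choice.\<close>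
  define J where "J x = (SOME j. x - of_nat j \<in> H)" for x
  have J: "x - of_nat (J x) \<in> H" for x unfolding J_def by (rule someI_ex[OF ex])
  define \<omega> where "\<omega> = cis (2 * pi / p)"
  have \<omega>p: "\<omega> ^ p = 1" 
    unfolding \<omega>_def Complex.DeMoivre using prime_gt_0_nat[OF p] by simp
  have cong: "\<omega> ^ i = \<omega> ^ j" if "of_nat i - of_nat j \<in> H" for i j
  proof -
    have *: "\<omega> ^ i = \<omega> ^ j" if "of_nat i - of_nat j \<in> H" "j \<le> i" for i j
    proof -
      have "p dvd i - j" using dvdI[of "i - j"] that by (simp add: of_nat_diff)
      then obtain l where "i - j = p * l" by (elim dvdE)
      hence "i = j + p * l" using that by simp
      thus ?thesis by (simp add: power_add power_mult \<omega>p)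
    qed
    show ?thesis
    proof (cases "j \<le> i")
      case True thus ?thesis using * that by blast
    next
      case False
      thus ?thesis using *[of j i] Hdiff[OF H0 that] by simp
    qed
  qed
  define \<psi> where "\<psi> x = \<omega> ^ J x" for x
  have eq: "\<psi> x = \<omega> ^ j" if "x - of_nat j \<in> H" for x j
    unfolding \<psi>_def using cong[of "J x" j] Hdiff[OF that J[of x]] by simp
  have "additive_character \<psi>"
  proof
    fix x y
    have "x + y - of_nat (J x + J y) \<in> H" using Hadd[OF J[of x] J[of y]] by (simp add: algebra_simps)
    from eq[OF this] show "\<psi> (x + y) = \<psi> x * \<psi> y" by (simp add: power_add \<psi>_def)
    show "cmod (\<psi> x) = 1" by (simp add: \<psi>_def \<omega>_def norm_power)
  next
    have "\<psi> 1 = \<omega>" using eq[of 1 1] H0 by simp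
    moreover have "\<omega> \<noteq> 1"
    proof
      assume "\<omega> = 1"
      hence "exp (2 * of_real pi * \<i> * of_nat 1 / of_nat p) = 1"
        by (simp add: \<omega>_def cis_conv_exp mult_ac)
      thus False
        using complex_root_unity_eq_1[of p 1] prime_gt_1_nat[OF p] by simp
    qed
    ultimately show "\<exists>x. \<psi> x \<noteq> 1" by metis
  qed
  thus ?thesis by blast
qed

section \<open>Gauss sums and Fourier transforms of spheres\<close>

lemma sum_over_fibres:
  fixes g :: "'b::finite \<Rightarrow> 'c::comm_semiring_1"
  assumes "finite I"
  shows "(\<Sum>i\<in>I. g (s i)) = (\<Sum>y\<in>UNIV. of_nat (card {i \<in> I. s i = y}) * g y)"
  using assms by (subst sum.group[of I UNIV s, symmetric]) auto

lemma two_neq_0_field: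
  assumes "odd CARD('a::{field,finite})"
  shows "(2 :: 'a) \<noteq> 0"
proof
  assume "(2 :: 'a) = 0"
  obtain n where "CARD('a) = 2 * n + 1" using assms by (elim oddE)
  hence "(of_nat CARD('a) :: 'a) = 2 * of_nat n + 1" by simp
  thus False using \<open>(2 :: 'a) = 0\<close> by (simp add: of_nat_card_field)
qed

text \<open>Here (q - 1) / 2 is odd, so a root of -1 raised to the power q - 1 would be -1, against
  Fermat.\<close>

lemma minus_one_nonsquare:
  fixes x :: "'a::{field,finite}"
  assumes "CARD('a) mod 4 = 3"
  shows "x\<^sup>2 \<noteq> -1"
proof
  assume x: "x\<^sup>2 = -1"
  have "CARD('a) = 4 * (CARD('a) div 4) + 3" using assms by (metis mult_div_mod_eq)
  then obtain n where n: "CARD('a) = 4 * n + 3" by blast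
  have "x \<noteq> 0" using x by auto
  hence "1 = x ^ (CARD('a) - 1)" using finite_field_fermat by metis
  also have "CARD('a) - 1 = 2 * (2 * n + 1)" using n by simp
  also have "x ^ \<dots> = -1" unfolding power_mult x by simp
  finally have "(2 :: 'a) = 0" by (simp add: eq_neg_iff_add_eq_0)
  thus False using two_neq_0_field[where 'a='a] n by simp
qed

text \<open>The \<open>itself\<close> parameter fixes the index type \<open>'n\<close>, so that
  \<open>h\<close> can be tied to its cardinality.\<close>

locale gauss_space = additive_character \<psi>
  for \<psi> :: "'a::{field,finite} \<Rightarrow> complex" +
  fixes dim :: "'n::finite itself" and h :: nat
  assumes card_mod_4: "CARD('a) mod 4 = 3"
    and dimension: "CARD('n) = 2 * h"
    and odd_h: "odd h"
begin

lemma q_ge_1: "real CARD('a) \<ge> 1"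
  using finite_UNIV_card_ge_0[where 'a='a] by (simp add: Suc_leI)

lemma two_neq_0 [simp]: "(2 :: 'a) \<noteq> 0"
proof (rule two_neq_0_field)
  show "odd CARD('a)"
    using card_mod_4 by presburger
qed

lemma four_neq_0 [simp]: "(4 :: 'a) \<noteq> 0"
  using two_neq_0 by (metis mult_2 mult_eq_0_iff numeral_Bit0)

section \<open>Quadratic Gauss sums and Gaussian integrals\<close>

definition gauss :: "'a \<Rightarrow> complex" where
  "gauss t = (\<Sum>x\<in>UNIV. \<psi> (t * x\<^sup>2))"

text \<open>Replacing \<open>x\<close> by \<open>x + y\<close> makes the phase linear in
  \<open>y\<close> with slope \<open>2 * t * x\<close>; orthogonality leaves
  \<open>x = 0\<close>.\<close>

lemma gauss_mult_cnj:
  assumes "t \<noteq> 0"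
  shows "gauss t * cnj (gauss t) = of_nat CARD('a)"
proof -
  have shift: "(\<Sum>x\<in>UNIV. g (x + y)) = (\<Sum>x\<in>UNIV. g x)" for g :: "'a \<Rightarrow> complex" and y
    by (rule sum.reindex_bij_witness[of _ "\<lambda>x. x - y" "\<lambda>x. x + y"]) auto
  have "gauss t * cnj (gauss t) = (\<Sum>y\<in>UNIV. \<Sum>x\<in>UNIV. \<psi> (t * x\<^sup>2 - t * y\<^sup>2))"
    unfolding gauss_def cnj_sum sum_product
    by (subst sum.swap) (simp add: diff)
  also have "\<dots> = (\<Sum>y\<in>UNIV. \<Sum>x\<in>UNIV. \<psi> (t * (x + y)\<^sup>2 - t * y\<^sup>2))"
    by (intro sum.cong refl shift[symmetric])
  also have "\<dots> = (\<Sum>x\<in>UNIV. \<Sum>y\<in>UNIV. \<psi> (t * x\<^sup>2) * \<psi> ((2 * t * x) * y))"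
    by (subst sum.swap) (simp add: power2_sum algebra_simps flip: add)
  also have "\<dots> = (\<Sum>x\<in>UNIV. \<psi> (t * x\<^sup>2) * (if x = 0 then of_nat CARD('a) else 0))"
    unfolding sum_distrib_left[symmetric] orthogonality using assms by simp
  also have "\<dots> = of_nat CARD('a)"
    by (simp add: if_distrib[of "(*) _"] cong: if_cong)
  finally show ?thesis .
qed

text \<open>Since \<open>-1\<close> is a nonsquare, \<open>x\<^sup>2\<close> and \<open>- x\<^sup>2\<close> together run twice through the field, so
  \<open>gauss t + gauss (- t) = 0\<close>.\<close>

lemma gauss_uminus:
  assumes "t \<noteq> 0"
  shows "gauss (- t) = - gauss t"
proof -
  \<comment> \<open>A root of \<open>- y\<close> divided by \<open>s\<close> would be a square root
    of -1.\<close>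
  have two_roots: "card {x. x\<^sup>2 = y} + card {x. x\<^sup>2 = - y} = 2"
    if s: "s\<^sup>2 = y" and y: "y \<noteq> 0" for s y :: 'a
  proof -
    have s0: "s \<noteq> 0" using s y by auto
    hence "s \<noteq> - s" by (metis add_eq_0_iff mult_2 mult_eq_0_iff two_neq_0)
    moreover have "{x. x\<^sup>2 = y} = {s, - s}" unfolding s[symmetric] power2_eq_iff by auto
    moreover have "x\<^sup>2 \<noteq> - y" for x
      using minus_one_nonsquare[OF card_mod_4, of "x / s"] s y by (auto simp: power_divide)
    hence "{x. x\<^sup>2 = - y} = {}" by blast
    ultimately show ?thesis by simp
  qed
  have fib: "card {x. x\<^sup>2 = y} + card {x. - x\<^sup>2 = y} = 2" for y :: 'a
  proof (cases "y = 0")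
    case False
    have "CARD('a) = 4 * (CARD('a) div 4) + 3" using card_mod_4 by (metis mult_div_mod_eq)
    then obtain n where n: "CARD('a) = 4 * n + 3" by blast
    \<comment> \<open>The exponent is half of q - 1, so \<open>y ^ (2 * n + 1)\<close> is 1 or -1.
      Hence \<open>y ^ (n + 1)\<close> is an explicit root of \<open>y\<close> or of
      \<open>- y\<close>.\<close>
    have "(2 * n + 1) * 2 = CARD('a) - 1" using n by simp
    hence "(y ^ (2 * n + 1))\<^sup>2 = y ^ (CARD('a) - 1)"
      by (simp only: power_mult[symmetric])
    hence "(y ^ (2 * n + 1))\<^sup>2 = 1" using finite_field_fermat[OF False] by simp
    hence "y ^ (2 * n + 1) = 1 \<or> y ^ (2 * n + 1) = -1" by (simp only: power2_eq_1_iff)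
    moreover have "(y ^ (n + 1))\<^sup>2 = y * y ^ (2 * n + 1)"
      by (simp add: power2_eq_square power_add mult_2)
    ultimately consider "(y ^ (n + 1))\<^sup>2 = y" | "(y ^ (n + 1))\<^sup>2 = - y" by force
    hence "card {x. x\<^sup>2 = y} + card {x. x\<^sup>2 = - y} = 2"
    proof cases
      case 1 thus ?thesis using two_roots False by blast
    next
      case 2 thus ?thesis using two_roots[of _ "- y"] False by force
    qed
    thus ?thesis by (simp add: minus_equation_iff[of _ y] eq_commute[of "- y"])
  qed simp
  have "gauss t + gauss (- t) = (\<Sum>x\<in>UNIV. \<psi> (t * x\<^sup>2)) + (\<Sum>x\<in>UNIV. \<psi> (t * - x\<^sup>2))"
    by (simp add: gauss_def)
  also have "\<dots> = (\<Sum>y\<in>UNIV. of_nat (card {x. x\<^sup>2 = y} + card {x. - x\<^sup>2 = y}) * \<psi> (t * y))"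
    using sum_over_fibres[of UNIV "\<lambda>y. \<psi> (t * y)" "\<lambda>x. x\<^sup>2"]
      sum_over_fibres[of UNIV "\<lambda>y. \<psi> (t * y)" "\<lambda>x. - x\<^sup>2"]
    by (simp add: sum.distrib distrib_right)
  also have "\<dots> = 0"
    unfolding fib using assms by (simp add: orthogonality flip: sum_distrib_left)
  finally show ?thesis by (simp add: add_eq_0_iff)
qed

text \<open>Conjugation replaces \<open>t\<close> by \<open>- t\<close>, so the Gauss sum is purely
  imaginary and its square is -q. The minus sign survives the odd power \<open>h\<close>.\<close>

lemma gauss_power:
  assumes "t \<noteq> 0"
  shows "gauss t ^ CARD('n) = - (of_nat CARD('a) ^ h)"
proof -
  have "cnj (gauss t) = - gauss t"
    unfolding gauss_uminus[OF assms, symmetric] by (simp add: gauss_def cnj_eq)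
  hence "(gauss t)\<^sup>2 = - of_nat CARD('a)"
    using gauss_mult_cnj[OF assms] by (simp add: power2_eq_square minus_equation_iff)
  thus ?thesis using odd_h by (simp add: dimension power_mult)
qed

text \<open>The sum factors over coordinates, and completing the square in each one leaves a Gauss
  sum times a phase. In this dimension the constant does not depend on \<open>t\<close>.\<close>

lemma sum_gaussian:
  fixes \<xi> :: "'a ^ 'n"
  assumes t: "t \<noteq> 0"
  shows "(\<Sum>x\<in>UNIV. \<psi> (t * qnorm x + dot x \<xi>)) = - (of_nat CARD('a) ^ h) * \<psi> (- qnorm \<xi> / (4 * t))"
proof -
  have coord: "(\<Sum>x\<in>UNIV. \<psi> (t * x\<^sup>2 + x * c)) = gauss t * \<psi> (- (c\<^sup>2) / (4 * t))" for c
  proof -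
    have "(\<Sum>x\<in>UNIV. \<psi> (t * x\<^sup>2 + x * c)) = (\<Sum>x\<in>UNIV. \<psi> (t * (x + c / (2 * t))\<^sup>2 + - (c\<^sup>2) / (4 * t)))"
    proof (intro sum.cong refl arg_cong[of _ _ \<psi>])
      fix x
      define b where "b = c / (2 * t)"
      have c: "c = 2 * t * b" using t by (simp add: b_def)
      have sq: "- (c\<^sup>2) / (4 * t) = - (t * b\<^sup>2)"
        using t unfolding c by (simp add: power_mult_distrib power2_eq_square)
      show "t * x\<^sup>2 + x * c = t * (x + c / (2 * t))\<^sup>2 + - (c\<^sup>2) / (4 * t)"
        unfolding sq b_def[symmetric] unfolding c by (simp add: power2_sum algebra_simps)
    qed
    also have "\<dots> = (\<Sum>x\<in>UNIV. \<psi> (t * (x + c / (2 * t))\<^sup>2)) * \<psi> (- (c\<^sup>2) / (4 * t))"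
      by (simp only: add sum_distrib_right)
    also have "(\<Sum>x\<in>UNIV. \<psi> (t * (x + c / (2 * t))\<^sup>2)) = gauss t"
      unfolding gauss_def
      by (rule sum.reindex_bij_witness[of _ "\<lambda>x. x - c / (2 * t)" "\<lambda>x. x + c / (2 * t)"]) auto
    finally show ?thesis .
  qed
  have "(\<Sum>x\<in>UNIV. \<psi> (t * qnorm x + dot x \<xi>))
      = (\<Sum>x\<in>UNIV. \<Prod>i\<in>UNIV. \<psi> (t * (x $ i)\<^sup>2 + x $ i * \<xi> $ i))"
    by (simp add: qnorm_def dot_def sum_distrib_left flip: sum.distrib sum_arg)
  also have "\<dots> = (\<Prod>i\<in>UNIV. gauss t * \<psi> (- ((\<xi> $ i)\<^sup>2) / (4 * t)))"
    by (subst sum_vec_prod) (simp add: coord)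
  also have "\<dots> = gauss t ^ CARD('n) * \<psi> (\<Sum>i\<in>UNIV. - ((\<xi> $ i)\<^sup>2) / (4 * t))"
    by (simp add: prod.distrib sum_arg)
  also have "(\<Sum>i\<in>UNIV. - ((\<xi> $ i)\<^sup>2) / (4 * t)) = - qnorm \<xi> / (4 * t)"
    by (simp add: qnorm_def sum_negf flip: sum_divide_distrib)
  finally show ?thesis by (simp add: gauss_power[OF t])
qed

section \<open>Fourier transforms of spheres and of the cone\<close>

text \<open>The condition \<open>qnorm m = r\<close> is detected by summing characters over
  \<open>t\<close>. The term \<open>t = 0\<close> gives the delta at 0, the others are Gaussian
  integrals, which assemble into a Kloosterman sum.\<close>

lemma sphere_transform:
  fixes \<xi> :: "'a ^ 'n"
  shows "of_nat CARD('a) * (\<Sum>m | qnorm m = r. \<psi> (dot m \<xi>))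
    = of_nat CARD('a) ^ (2 * h) * of_bool (\<xi> = 0)
      - of_nat CARD('a) ^ h * (\<Sum>t\<in>UNIV - {0}. \<psi> (- (t * r) - qnorm \<xi> / (4 * t)))"
proof -
  have "of_nat CARD('a) * (\<Sum>m | qnorm m = r. \<psi> (dot m \<xi>))
      = (\<Sum>m\<in>UNIV. \<psi> (dot m \<xi>) * (if qnorm m - r = 0 then of_nat CARD('a) else 0))"
    by (simp add: sum_distrib_left mult.commute sum.If_cases if_distrib[of "(*) _"] cong: if_cong)
  also have "\<dots> = (\<Sum>m\<in>UNIV. \<Sum>t\<in>UNIV. \<psi> (dot m \<xi>) * \<psi> ((qnorm m - r) * t))"
    unfolding orthogonality[symmetric] by (simp only: sum_distrib_left)
  also have "\<dots> = (\<Sum>t\<in>UNIV. \<Sum>m\<in>UNIV. \<psi> (dot m \<xi>) * \<psi> ((qnorm m - r) * t))"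
    by (rule sum.swap)
  also have "\<dots> = (\<Sum>m\<in>UNIV. \<psi> (dot m \<xi>))
      + (\<Sum>t\<in>UNIV - {0}. \<Sum>m\<in>UNIV. \<psi> (dot m \<xi>) * \<psi> ((qnorm m - r) * t))"
    by (subst sum.remove[of _ 0]) auto
  also have "(\<Sum>t\<in>UNIV - {0}. \<Sum>m\<in>UNIV. \<psi> (dot m \<xi>) * \<psi> ((qnorm m - r) * t))
      = (\<Sum>t\<in>UNIV - {0}. (\<Sum>m\<in>UNIV. \<psi> (t * qnorm m + dot m \<xi>)) * \<psi> (- (t * r)))"
    by (simp add: algebra_simps sum_distrib_left flip: add)
  also have "\<dots> = - (of_nat CARD('a) ^ h * (\<Sum>t\<in>UNIV - {0}. \<psi> (- (t * r) - qnorm \<xi> / (4 * t))))"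
  proof -
    have "\<psi> (- qnorm \<xi> / (4 * t)) * \<psi> (- (t * r)) = \<psi> (- (t * r) - qnorm \<xi> / (4 * t))" for t
      by (simp add: add[symmetric] algebra_simps)
    thus ?thesis by (simp add: sum_gaussian sum_distrib_left sum_negf mult.assoc)
  qed
  finally show ?thesis by (simp add: orthogonality_dot dimension)
qed

text \<open>At radius 0 the substitution \<open>u = - 1 / (4 * t)\<close> makes the phase linear, so
  the Kloosterman sum is evaluated by orthogonality.\<close>

lemma cone_transform:
  fixes \<xi> :: "'a ^ 'n"
  shows "of_nat CARD('a) * (\<Sum>m\<in>sphere0. \<psi> (dot m \<xi>))
    = of_nat CARD('a) ^ (2 * h) * of_bool (\<xi> = 0)
      - of_nat CARD('a) ^ h * (of_nat CARD('a) * of_bool (qnorm \<xi> = 0) - 1)"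
proof -
  have "(\<Sum>t\<in>UNIV - {0}. \<psi> (- qnorm \<xi> / (4 * t))) = (\<Sum>u\<in>UNIV - {0}. \<psi> (qnorm \<xi> * u))"
    by (rule sum.reindex_bij_witness[of _ "\<lambda>u. - 1 / (4 * u)" "\<lambda>t. - 1 / (4 * t)"]) auto
  thus ?thesis
    using sphere_transform[of \<xi> 0] by (simp add: sphere0_def orthogonality_nz)
qed

text \<open>Because \<open>h\<close> is odd, the pairs with \<open>qnorm (p i - p j) = 0\<close> enter with a negative sign.\<close>

lemma cone_second_moment:
  fixes p :: "'i \<Rightarrow> 'a ^ 'n" and w :: "'i \<Rightarrow> complex"
  shows "complex_of_real (real CARD('a) * (\<Sum>x\<in>sphere0. (cmod (\<Sum>i\<in>I. w i * \<psi> (dot x (p i))))\<^sup>2))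
    = (\<Sum>i\<in>I. \<Sum>j\<in>I. w i * cnj (w j) *
        (of_nat CARD('a) ^ (2 * h) * of_bool (p i = p j)
          - of_nat CARD('a) ^ h * (of_nat CARD('a) * of_bool (qnorm (p i - p j) = 0) - 1)))"
proof -
  have "complex_of_real (\<Sum>x\<in>sphere0. (cmod (\<Sum>i\<in>I. w i * \<psi> (dot x (p i))))\<^sup>2)
      = (\<Sum>x\<in>sphere0. \<Sum>i\<in>I. \<Sum>j\<in>I. w i * cnj (w j) * \<psi> (dot x (p i - p j)))"
    unfolding of_real_sum cmod_sum_squared_eq by (simp add: diff dot_diff_right mult_ac)
  also have "\<dots> = (\<Sum>i\<in>I. \<Sum>j\<in>I. \<Sum>x\<in>sphere0. w i * cnj (w j) * \<psi> (dot x (p i - p j)))"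
    by (subst sum.swap, intro sum.cong refl sum.swap)
  finally have *: "complex_of_real (\<Sum>x\<in>sphere0. (cmod (\<Sum>i\<in>I. w i * \<psi> (dot x (p i))))\<^sup>2)
      = (\<Sum>i\<in>I. \<Sum>j\<in>I. w i * cnj (w j) * (\<Sum>x\<in>sphere0. \<psi> (dot x (p i - p j))))"
    by (simp add: sum_distrib_left)
  have "complex_of_real (real CARD('a) * (\<Sum>x\<in>sphere0. (cmod (\<Sum>i\<in>I. w i * \<psi> (dot x (p i))))\<^sup>2))
      = (\<Sum>i\<in>I. \<Sum>j\<in>I. w i * cnj (w j) * (of_nat CARD('a) * (\<Sum>x\<in>sphere0. \<psi> (dot x (p i - p j)))))"
    unfolding of_real_mult * by (simp add: sum_distrib_left mult_ac)
  thus ?thesis by (simp only: cone_transform right_minus_eq)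
qed

section \<open>Energy of the Fourier transform on spheres\<close>

text \<open>Apply the second moment with unit weights. Pairs with isotropic difference contribute
  negatively and may be discarded; the diagonal and one \<open>q ^ h\<close> per pair
  remain.\<close>

lemma cone_energy_le:
  fixes A :: "('a ^ 'n) set"
  shows "real CARD('a) * (\<Sum>m\<in>sphere0. (cmod (\<Sum>a\<in>A. \<psi> (dot m a)))\<^sup>2)
    \<le> real CARD('a) ^ (2 * h) * card A + real CARD('a) ^ h * (real (card A))\<^sup>2"
proof -
  define g :: "'a ^ 'n \<Rightarrow> 'a ^ 'n \<Rightarrow> real" where
    "g a b = real CARD('a) ^ (2 * h) * of_bool (a = b)
      - real CARD('a) ^ h * (real CARD('a) * of_bool (qnorm (a - b) = 0) - 1)" for a b
  have g_le: "g a b \<le> real CARD('a) ^ (2 * h) * of_bool (a = b) + real CARD('a) ^ h" for a b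
    by (auto simp: g_def algebra_simps)
  have "complex_of_real (real CARD('a) * (\<Sum>m\<in>sphere0. (cmod (\<Sum>a\<in>A. \<psi> (dot m a)))\<^sup>2))
      = complex_of_real (\<Sum>a\<in>A. \<Sum>b\<in>A. g a b)"
    using cone_second_moment[of "\<lambda>_. 1" "\<lambda>a. a" A] by (simp add: g_def)
  hence "real CARD('a) * (\<Sum>m\<in>sphere0. (cmod (\<Sum>a\<in>A. \<psi> (dot m a)))\<^sup>2) = (\<Sum>a\<in>A. \<Sum>b\<in>A. g a b)"
    by (simp only: of_real_eq_iff)
  also have "\<dots> \<le> (\<Sum>a\<in>A. \<Sum>b\<in>A. real CARD('a) ^ (2 * h) * of_bool (a = b) + real CARD('a) ^ h)"
    by (intro sum_mono g_le)
  also have "\<dots> = real CARD('a) ^ (2 * h) * card A + real CARD('a) ^ h * (real (card A))\<^sup>2"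
    by (simp add: sum.distrib power2_eq_square algebra_simps flip: sum_distrib_left)
  finally show ?thesis .
qed

section \<open>Second moment of Kloosterman sums over the cone\<close>

text \<open>Only pairs with \<open>w *s a = v *s b\<close> count. If \<open>a = c *s b\<close> is
  nonzero, then \<open>v = c * w\<close>, and the remaining one-variable sum is q - 1 for
  \<open>c = 1\<close> and -1 otherwise: the upper bound sees only the diagonal.\<close>

lemma collinear_correlation:
  fixes a b :: "'a ^ 'n"
  assumes r: "r \<noteq> 0"
  obtains d where
    "(\<Sum>v\<in>UNIV - {0}. \<Sum>w\<in>UNIV - {0}. \<psi> (- (v * r)) * cnj (\<psi> (- (w * r)))
        * of_bool ((1 / (2 * v)) *s a = (1 / (2 * w)) *s b)) = complex_of_real d"
    "d \<le> real CARD('a) * of_bool (a = b)"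
proof -
  let ?D = "\<Sum>v\<in>UNIV - {0}. \<Sum>w\<in>UNIV - {0}. \<psi> (- (v * r)) * cnj (\<psi> (- (w * r)))
    * of_bool ((1 / (2 * v)) *s a = (1 / (2 * w)) *s b)"
  have E: "(\<Sum>v\<in>UNIV - {0}. \<psi> (- (v * r))) = -1"
    using orthogonality_nz[of "- r"] r by (simp add: mult.commute)
  have iff: "(1 / (2 * v)) *s a = (1 / (2 * w)) *s b \<longleftrightarrow> w *s a = v *s b"
    if "v \<noteq> 0" "w \<noteq> 0" for v w
    using that by (simp add: vec_eq_iff field_simps)
  have line: "?D = (\<Sum>w\<in>UNIV - {0}. \<psi> ((r * (1 - c)) * w))"
    if c: "a = c *s b" "c \<noteq> 0" "b \<noteq> 0" for c
  proof -
    obtain i where i: "b $ i \<noteq> 0" using \<open>b \<noteq> 0\<close> by (auto simp: vec_eq_iff)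
    have "w *s a = v *s b \<longleftrightarrow> v = c * w" for v w
      using i by (auto simp: c(1) vec_eq_iff mult_ac)
    hence "(1 / (2 * v)) *s a = (1 / (2 * w)) *s b \<longleftrightarrow> v = c * w" if "v \<noteq> 0" "w \<noteq> 0" for v w
      using iff that by blast
    hence "?D = (\<Sum>v\<in>UNIV - {0}. \<Sum>w\<in>UNIV - {0}. \<psi> (- (v * r)) * cnj (\<psi> (- (w * r))) * of_bool (v = c * w))"
      by (intro sum.cong refl) simp
    also have "\<dots> = (\<Sum>w\<in>UNIV - {0}. \<Sum>v\<in>UNIV - {0}. \<psi> (- (v * r)) * cnj (\<psi> (- (w * r))) * of_bool (v = c * w))"
      by (rule sum.swap)
    also have "\<dots> = (\<Sum>w\<in>UNIV - {0}. \<psi> (- (c * w * r)) * cnj (\<psi> (- (w * r))))"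
      using c(2) by (intro sum.cong refl) (simp add: of_bool_def if_distrib[of "(*) _"] cong: if_cong)
    also have "\<dots> = (\<Sum>w\<in>UNIV - {0}. \<psi> ((r * (1 - c)) * w))"
      unfolding diff[symmetric] by (intro sum.cong refl arg_cong[of _ _ \<psi>]) (simp add: algebra_simps)
    finally show ?thesis .
  qed
  consider "a = 0" "b = 0" | "a = b" "b \<noteq> 0"
    | c where "a = c *s b" "c \<noteq> 0" "b \<noteq> 0" "c \<noteq> 1"
    | "a \<noteq> b" "\<And>v w. v \<noteq> 0 \<Longrightarrow> w \<noteq> 0 \<Longrightarrow> w *s a \<noteq> v *s b"
  proof -
    have "\<exists>c. a = c *s b \<and> c \<noteq> 0" if "w *s a = v *s b" "v \<noteq> 0" "w \<noteq> 0" for v w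
      using that by (intro exI[of _ "v / w"]) (simp add: vec_eq_iff field_simps)
    thus ?thesis using that by (metis vector_smult_lid vector_smult_rzero)
  qed
  thus ?thesis
  proof cases
    case 1
    \<comment> \<open>Every pair counts here, so the double sum is a product of two sums equal to
      -1.\<close>
    have "?D = 1"
      using E by (simp add: 1 flip: sum_product cnj_sum)
    thus ?thesis using that[of 1] q_ge_1 1 by simp
  next
    case 2
    have "?D = complex_of_real (real CARD('a) - 1)"
      using line[of 1] 2 q_ge_1 by (simp add: card_Diff_singleton of_nat_diff)
    thus ?thesis using that[of "real CARD('a) - 1"] 2 by simp
  next
    case 3
    have "?D = complex_of_real (-1)"
      using line[OF 3(1-3)] orthogonality_nz[of "r * (1 - c)"] r 3(4) by simp
    thus ?thesis using that[of "-1"] by simp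
  next
    case 4
    have "?D = complex_of_real 0"
      by (intro sum.neutral ballI trans[OF sum.neutral of_real_0[symmetric]]) (use 4 iff in auto)
    thus ?thesis using that[of 0] by simp
  qed
qed

text \<open>A sum over \<open>a\<close> of Kloosterman sums with parameters \<open>r\<close> and
  \<open>dot x a\<close>. Scaling \<open>a\<close> inside the inner product displays it as a
  character sum in \<open>x\<close> with frequencies indexed by \<open>(a, v)\<close>, as
  \<open>cone_second_moment\<close> requires.\<close>

definition kloosterman_sum :: "('a ^ 'n) set \<Rightarrow> 'a \<Rightarrow> 'a ^ 'n \<Rightarrow> complex" where
  "kloosterman_sum A r x =
    (\<Sum>a\<in>A. \<Sum>v\<in>UNIV - {0}. \<psi> (- (v * r)) * \<psi> (dot x ((1 / (2 * v)) *s a)))"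

text \<open>Coinciding frequencies are controlled by \<open>collinear_correlation\<close>. The
  isotropy condition depends on \<open>a\<close> and \<open>b\<close> alone, so there the sums over
  \<open>v\<close> and \<open>v'\<close> decouple.\<close>

lemma kloosterman_sum_moment_le:
  fixes A :: "('a ^ 'n) set"
  assumes A: "A \<subseteq> sphere0" and r: "r \<noteq> 0"
  shows "real CARD('a) * (\<Sum>x\<in>sphere0. (cmod (kloosterman_sum A r x))\<^sup>2)
    \<le> real CARD('a) ^ (2 * h) * (real CARD('a) * card A) + real CARD('a) ^ h * (real (card A))\<^sup>2"
proof -
  let ?N = "UNIV - {0 :: 'a}"
  define w :: "('a ^ 'n) \<times> 'a \<Rightarrow> complex" where "w = (\<lambda>(a, v). \<psi> (- (v * r)))"
  define p :: "('a ^ 'n) \<times> 'a \<Rightarrow> 'a ^ 'n" where "p = (\<lambda>(a, v). (1 / (2 * v)) *s a)"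
  have Y: "kloosterman_sum A r x = (\<Sum>i\<in>A \<times> ?N. w i * \<psi> (dot x (p i)))" for x
    by (simp add: kloosterman_sum_def sum.cartesian_product w_def p_def case_prod_beta)
  define c where "c a b = real CARD('a) ^ h * (real CARD('a) * of_bool (dot a b = 0) - 1)"
    for a b :: "'a ^ 'n"
  have E: "(\<Sum>v\<in>?N. \<psi> (- (v * r))) = -1"
    using orthogonality_nz[of "- r"] r by (simp add: mult.commute)
  have "\<forall>a b. \<exists>d. (\<Sum>v\<in>?N. \<Sum>v'\<in>?N. w (a, v) * cnj (w (b, v')) * of_bool (p (a, v) = p (b, v')))
      = complex_of_real d \<and> d \<le> real CARD('a) * of_bool (a = b)"
    unfolding w_def p_def prod.case by (metis collinear_correlation[OF r])
  then obtain d where d: "\<And>a b. (\<Sum>v\<in>?N. \<Sum>v'\<in>?N. w (a, v) * cnj (w (b, v')) * of_bool (p (a, v) = p (b, v')))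
      = complex_of_real (d a b)" "\<And>a b. d a b \<le> real CARD('a) * of_bool (a = b)"
    by metis
  have pairs: "(\<Sum>i\<in>A \<times> ?N. F i) = (\<Sum>a\<in>A. \<Sum>v\<in>?N. F (a, v))"
    for F :: "('a ^ 'n) \<times> 'a \<Rightarrow> complex"
    by (simp add: sum.cartesian_product)
  \<comment> \<open>For isotropic \<open>a\<close> and \<open>b\<close>, the norm of the difference
    is a nonzero multiple of \<open>dot a b\<close>.\<close>
  have qn: "qnorm (p (a, v) - p (b, v')) = 0 \<longleftrightarrow> dot a b = 0"
    if "a \<in> A" "b \<in> A" "v \<noteq> 0" "v' \<noteq> 0" for a b v v'
  proof -
    have "qnorm a = 0" "qnorm b = 0" using that A by (auto simp: sphere0_def)
    thus ?thesis using that
      by (simp add: p_def qnorm_diff qnorm_scale dot_scale_right dot_commute[of "_ *s a"] dot_commute[of b])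
  qed
  have "complex_of_real (real CARD('a) * (\<Sum>x\<in>sphere0. (cmod (kloosterman_sum A r x))\<^sup>2))
      = (\<Sum>i\<in>A \<times> ?N. \<Sum>j\<in>A \<times> ?N. w i * cnj (w j) *
        (of_nat CARD('a) ^ (2 * h) * of_bool (p i = p j)
          - of_nat CARD('a) ^ h * (of_nat CARD('a) * of_bool (qnorm (p i - p j) = 0) - 1)))"
    unfolding Y by (rule cone_second_moment)
  also have "\<dots> = (\<Sum>a\<in>A. \<Sum>v\<in>?N. \<Sum>b\<in>A. \<Sum>v'\<in>?N. w (a, v) * cnj (w (b, v')) *
        (of_nat CARD('a) ^ (2 * h) * of_bool (p (a, v) = p (b, v'))
          - of_nat CARD('a) ^ h * (of_nat CARD('a) * of_bool (qnorm (p (a, v) - p (b, v')) = 0) - 1)))"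
    by (simp only: pairs)
  also have "\<dots> = (\<Sum>a\<in>A. \<Sum>b\<in>A. \<Sum>v\<in>?N. \<Sum>v'\<in>?N.
        of_nat CARD('a) ^ (2 * h) * (w (a, v) * cnj (w (b, v')) * of_bool (p (a, v) = p (b, v')))
          - complex_of_real (c a b) * (\<psi> (- (v * r)) * cnj (\<psi> (- (v' * r)))))"
    by (intro sum.cong refl, subst sum.swap, intro sum.cong refl)
      (simp add: qn c_def w_def algebra_simps)
  \<comment> \<open>The decoupled sums over \<open>v\<close> and \<open>v'\<close> are both -1, so
    their product leaves \<open>c a b\<close> unchanged.\<close>
  also have "\<dots> = complex_of_real (\<Sum>a\<in>A. \<Sum>b\<in>A. real CARD('a) ^ (2 * h) * d a b - c a b)"
    unfolding sum_subtractf sum_distrib_left[symmetric] d sum_product[symmetric] cnj_sum[symmetric] E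
    by (simp add: sum_negf E)
  finally have "real CARD('a) * (\<Sum>x\<in>sphere0. (cmod (kloosterman_sum A r x))\<^sup>2)
      = (\<Sum>a\<in>A. \<Sum>b\<in>A. real CARD('a) ^ (2 * h) * d a b - c a b)"
    by (simp only: of_real_eq_iff)
  also have "\<dots> \<le> (\<Sum>a\<in>A. \<Sum>b\<in>A. real CARD('a) ^ (2 * h) * (real CARD('a) * of_bool (a = b)) + real CARD('a) ^ h)"
  proof (intro sum_mono)
    fix a b :: "'a ^ 'n"
    have "- c a b \<le> real CARD('a) ^ h" by (auto simp: c_def algebra_simps)
    moreover have "real CARD('a) ^ (2 * h) * d a b \<le> real CARD('a) ^ (2 * h) * (real CARD('a) * of_bool (a = b))"
      by (intro mult_left_mono d) auto
    ultimately show "real CARD('a) ^ (2 * h) * d a b - c a b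
        \<le> real CARD('a) ^ (2 * h) * (real CARD('a) * of_bool (a = b)) + real CARD('a) ^ h" by linarith
  qed
  also have "\<dots> = real CARD('a) ^ (2 * h) * (real CARD('a) * card A) + real CARD('a) ^ h * (real (card A))\<^sup>2"
    by (simp add: sum.distrib power2_eq_square algebra_simps flip: sum_distrib_left)
  finally show ?thesis .
qed

text \<open>For \<open>r = 0\<close> this is the cone bound. Otherwise the diagonal gives one unit
  of \<open>q ^ (2 * h) * card A\<close>, and the Kloosterman average at most two more.\<close>

lemma sphere_energy_le:
  fixes A :: "('a ^ 'n) set"
  assumes A: "A \<subseteq> sphere0" and small: "real (card A) \<le> real CARD('a) ^ h"
  shows "real CARD('a) * (\<Sum>m | qnorm m = r. (cmod (\<Sum>a\<in>A. \<psi> (dot m a)))\<^sup>2)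
    \<le> 3 * real CARD('a) ^ (2 * h) * card A"
proof (cases "r = 0")
  case True
  have "real CARD('a) ^ h * (real (card A))\<^sup>2 \<le> real CARD('a) ^ h * (real CARD('a) ^ h * real (card A))"
    unfolding power2_eq_square using small by (intro mult_left_mono mult_right_mono) auto
  also have "\<dots> = real CARD('a) ^ (2 * h) * card A"
    by (simp add: mult_2 power_add)
  finally have "real CARD('a) * (\<Sum>m\<in>sphere0. (cmod (\<Sum>a\<in>A. \<psi> (dot m a)))\<^sup>2)
      \<le> 2 * (real CARD('a) ^ (2 * h) * card A)"
    using cone_energy_le[of A] by linarith
  also have "\<dots> \<le> 3 * (real CARD('a) ^ (2 * h) * card A)"
    by (intro mult_right_mono) auto
  finally show ?thesis using True by (simp add: sphere0_def mult.assoc)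
next
  case False
  let ?S = "cmod (\<Sum>a\<in>A. kloosterman_sum A r a)"
  have "complex_of_real (\<Sum>m | qnorm m = r. (cmod (\<Sum>a\<in>A. \<psi> (dot m a)))\<^sup>2)
      = (\<Sum>m | qnorm m = r. \<Sum>a\<in>A. \<Sum>b\<in>A. \<psi> (dot m (a - b)))"
    unfolding of_real_sum cmod_sum_squared_eq by (simp add: diff dot_diff_right)
  also have "\<dots> = (\<Sum>a\<in>A. \<Sum>b\<in>A. \<Sum>m | qnorm m = r. \<psi> (dot m (a - b)))"
    by (subst sum.swap, intro sum.cong refl sum.swap)
  finally have *: "complex_of_real (\<Sum>m | qnorm m = r. (cmod (\<Sum>a\<in>A. \<psi> (dot m a)))\<^sup>2)
      = (\<Sum>a\<in>A. \<Sum>b\<in>A. \<Sum>m | qnorm m = r. \<psi> (dot m (a - b)))" .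
  have "complex_of_real (real CARD('a) * (\<Sum>m | qnorm m = r. (cmod (\<Sum>a\<in>A. \<psi> (dot m a)))\<^sup>2))
      = (\<Sum>a\<in>A. \<Sum>b\<in>A. of_nat CARD('a) * (\<Sum>m | qnorm m = r. \<psi> (dot m (a - b))))"
    unfolding of_real_mult * by (simp add: sum_distrib_left)
  also have "\<dots> = (\<Sum>a\<in>A. \<Sum>b\<in>A. of_nat CARD('a) ^ (2 * h) * of_bool (a = b)
      - of_nat CARD('a) ^ h * (\<Sum>v\<in>UNIV - {0}. \<psi> (- (v * r)) * \<psi> (dot a ((1 / (2 * v)) *s b))))"
  proof (intro sum.cong refl)
    fix a b assume "a \<in> A" "b \<in> A"
    hence "qnorm a = 0" "qnorm b = 0" using A by (auto simp: sphere0_def)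
    \<comment> \<open>Isotropy turns the phase of \<open>sphere_transform\<close> into
      \<open>dot a b / (2 * v)\<close>, the phase of \<open>kloosterman_sum\<close>.\<close>
    hence qn: "qnorm (a - b) = - (2 * dot a b)" by (simp add: qnorm_diff)
    have half: "- (2 * x) / (4 * v) = - (x / (2 * v))" for x v :: 'a
    proof -
      have "- (2 * x) / (4 * v) = - ((2 * x) / (2 * (2 * v)))" by simp
      also have "(2 * x) / (2 * (2 * v)) = x / (2 * v)"
        by (rule mult_divide_mult_cancel_left) (rule two_neq_0)
      finally show ?thesis .
    qed
    have "\<psi> (- (v * r) - qnorm (a - b) / (4 * v)) = \<psi> (- (v * r)) * \<psi> (dot a ((1 / (2 * v)) *s b))" for v
      unfolding add[symmetric] qn half dot_scale_right by simp
    thus "of_nat CARD('a) * (\<Sum>m | qnorm m = r. \<psi> (dot m (a - b)))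
      = of_nat CARD('a) ^ (2 * h) * of_bool (a = b)
        - of_nat CARD('a) ^ h * (\<Sum>v\<in>UNIV - {0}. \<psi> (- (v * r)) * \<psi> (dot a ((1 / (2 * v)) *s b)))"
      unfolding sphere_transform by simp
  qed
  also have "\<dots> = of_nat CARD('a) ^ (2 * h) * of_nat (card A)
      - of_nat CARD('a) ^ h * (\<Sum>a\<in>A. kloosterman_sum A r a)"
    unfolding sum_subtractf kloosterman_sum_def sum_distrib_left[symmetric] by simp
  finally have "real CARD('a) * (\<Sum>m | qnorm m = r. (cmod (\<Sum>a\<in>A. \<psi> (dot m a)))\<^sup>2)
      = Re (of_nat CARD('a) ^ (2 * h) * of_nat (card A)
        - of_nat CARD('a) ^ h * (\<Sum>a\<in>A. kloosterman_sum A r a))"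
    by (metis Re_complex_of_real)
  also have "\<dots> = real CARD('a) ^ (2 * h) * card A
      - real CARD('a) ^ h * Re (\<Sum>a\<in>A. kloosterman_sum A r a)"
    by (simp flip: of_nat_power of_nat_mult)
  also have "\<dots> \<le> real CARD('a) ^ (2 * h) * card A + real CARD('a) ^ h * ?S"
  proof -
    have "- ?S \<le> Re (\<Sum>a\<in>A. kloosterman_sum A r a)"
      using abs_Re_le_cmod[of "\<Sum>a\<in>A. kloosterman_sum A r a"] by linarith
    hence "real CARD('a) ^ h * (- ?S) \<le> real CARD('a) ^ h * Re (\<Sum>a\<in>A. kloosterman_sum A r a)"
      by (intro mult_left_mono) auto
    thus ?thesis by simp
  qed
  finally have le: "real CARD('a) * (\<Sum>m | qnorm m = r. (cmod (\<Sum>a\<in>A. \<psi> (dot m a)))\<^sup>2)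
      \<le> real CARD('a) ^ (2 * h) * card A + real CARD('a) ^ h * ?S" .
  have sq: "real CARD('a) ^ (2 * h) = real CARD('a) ^ h * real CARD('a) ^ h"
    by (simp add: mult_2 power_add)
  \<comment> \<open>Cauchy-Schwarz over \<open>A\<close>, then enlarging \<open>A\<close> to the
    whole cone, reduces this to the second moment.\<close>
  have "?S \<le> 2 * real CARD('a) ^ h * card A"
  proof (rule power2_le_imp_le)
    have "?S\<^sup>2 \<le> card A * (\<Sum>a\<in>A. (cmod (kloosterman_sum A r a))\<^sup>2)"
      by (rule cmod_sum_squared_le)
    also have "\<dots> \<le> card A * (\<Sum>a\<in>sphere0. (cmod (kloosterman_sum A r a))\<^sup>2)"
      using A by (intro mult_left_mono sum_mono2) auto
    finally have "real CARD('a) * ?S\<^sup>2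
        \<le> card A * (real CARD('a) * (\<Sum>a\<in>sphere0. (cmod (kloosterman_sum A r a))\<^sup>2))"
      using q_ge_1 by (simp add: mult.left_commute)
    also have "\<dots> \<le> card A * (real CARD('a) ^ (2 * h) * (real CARD('a) * card A)
        + real CARD('a) ^ h * (real (card A))\<^sup>2)"
      by (intro mult_left_mono kloosterman_sum_moment_le A False) auto
    also have "\<dots> \<le> card A * (real CARD('a) ^ (2 * h) * (real CARD('a) * card A)
        + real CARD('a) ^ h * (real CARD('a) * (real CARD('a) ^ h * card A)))"
    proof (intro mult_left_mono add_left_mono)
      have "real (card A) * card A \<le> real CARD('a) ^ h * card A"
        using small by (intro mult_right_mono) auto
      also have "\<dots> \<le> real CARD('a) * (real CARD('a) ^ h * card A)"
        using q_ge_1 mult_right_mono[of 1 "real CARD('a)" "real CARD('a) ^ h * card A"] by simp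
      finally show "(real (card A))\<^sup>2 \<le> real CARD('a) * (real CARD('a) ^ h * card A)"
        by (simp add: power2_eq_square)
    qed auto
    also have "\<dots> = 2 * (real CARD('a) * (real CARD('a) ^ h * card A)\<^sup>2)"
      unfolding sq power2_eq_square by (simp only: algebra_simps)
    \<comment> \<open>Rounding 2 up to the square 4 keeps the root of the constant an
      integer.\<close>
    also have "\<dots> \<le> 4 * (real CARD('a) * (real CARD('a) ^ h * card A)\<^sup>2)"
      by (intro mult_right_mono) auto
    also have "\<dots> = real CARD('a) * (2 * real CARD('a) ^ h * card A)\<^sup>2"
      by (simp add: power_mult_distrib)
    finally show "?S\<^sup>2 \<le> (2 * real CARD('a) ^ h * card A)\<^sup>2"
      using q_ge_1 by simp
  qed simp
  hence "real CARD('a) ^ h * ?S \<le> real CARD('a) ^ h * (2 * real CARD('a) ^ h * card A)"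
    by (intro mult_left_mono) auto
  also have "\<dots> = 2 * (real CARD('a) ^ (2 * h) * card A)"
    unfolding sq by simp
  finally show ?thesis using le by (simp add: mult.assoc)
qed

section \<open>Distance energy\<close>

text \<open>The frequency \<open>s = 0\<close> is left out because it carries the main term, the
  square of \<open>card A * card B\<close>.\<close>

definition energy :: "('a ^ 'n) set \<Rightarrow> ('a ^ 'n) set \<Rightarrow> real" where
  "energy A B = (\<Sum>s\<in>UNIV - {0}. (cmod (\<Sum>a\<in>A. \<Sum>b\<in>B. \<psi> (s * qnorm (a - b))))\<^sup>2)"

text \<open>Gaussian integrals move the problem to frequencies \<open>m\<close> grouped by norm.
  Parseval in the norm, Cauchy-Schwarz on each sphere, the uniform sphere bound for \<open>A\<close>
  and Parseval for \<open>B\<close> finish.\<close>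

lemma energy_le_small:
  fixes A B :: "('a ^ 'n) set"
  assumes A: "A \<subseteq> sphere0" and small: "real (card A) \<le> real CARD('a) ^ h"
  shows "energy A B \<le> 3 * real CARD('a) ^ (2 * h) * card A * card B"
proof -
  define fA where "fA m = (\<Sum>a\<in>A. \<psi> (dot m a))" for m
  define fB where "fB m = (\<Sum>b\<in>B. \<psi> (dot m b))" for m
  define P where "P r = (\<Sum>m | qnorm m = r. fA m * cnj (fB m))" for r
  define T where "T s = (\<Sum>a\<in>A. \<Sum>b\<in>B. \<psi> (s * qnorm (a - b)))" for s
  \<comment> \<open>This is \<open>sum_gaussian\<close> read backwards at \<open>a - b\<close>: the
    distance reappears with multiplier \<open>- 1 / (4 * t)\<close>, an involution of the nonzero
    scalars.\<close>
  have PT: "(\<Sum>r\<in>UNIV. P r * \<psi> (t * r)) = - (of_nat CARD('a) ^ h) * T (- 1 / (4 * t))"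
    if t: "t \<noteq> 0" for t
  proof -
    have "(\<Sum>r\<in>UNIV. P r * \<psi> (t * r))
        = (\<Sum>r\<in>UNIV. \<Sum>m | m \<in> UNIV \<and> qnorm m = r. fA m * cnj (fB m) * \<psi> (t * qnorm m))"
      by (simp add: P_def sum_distrib_right)
    also have "\<dots> = (\<Sum>m\<in>UNIV. fA m * cnj (fB m) * \<psi> (t * qnorm m))"
      by (rule sum.group) auto
    also have "\<dots> = (\<Sum>m\<in>UNIV. \<Sum>a\<in>A. \<Sum>b\<in>B. \<psi> (t * qnorm m + dot m (a - b)))"
      unfolding fA_def fB_def cnj_sum sum_product
      by (simp add: dot_diff_right diff add sum_distrib_left mult_ac)
    also have "\<dots> = (\<Sum>a\<in>A. \<Sum>b\<in>B. \<Sum>m\<in>UNIV. \<psi> (t * qnorm m + dot m (a - b)))"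
      by (subst sum.swap, intro sum.cong refl sum.swap)
    also have "\<dots> = - (of_nat CARD('a) ^ h) * T (- 1 / (4 * t))"
      unfolding sum_gaussian[OF t] T_def by (simp add: sum_distrib_left)
    finally show ?thesis .
  qed
  have "real CARD('a) ^ (2 * h) * energy A B
      = (\<Sum>s\<in>UNIV - {0}. (cmod (- (of_nat CARD('a) ^ h) * T s))\<^sup>2)"
    unfolding energy_def T_def[symmetric]
    by (simp add: norm_mult norm_power power_mult_distrib sum_distrib_left power_mult[symmetric] mult.commute)
  also have "\<dots> = (\<Sum>t\<in>UNIV - {0}. (cmod (- (of_nat CARD('a) ^ h) * T (- 1 / (4 * t))))\<^sup>2)"
    by (rule sum.reindex_bij_witness[of _ "\<lambda>t. - 1 / (4 * t)" "\<lambda>t. - 1 / (4 * t)"]) auto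
  also have "\<dots> = (\<Sum>t\<in>UNIV - {0}. (cmod (\<Sum>r\<in>UNIV. P r * \<psi> (t * r)))\<^sup>2)"
    by (intro sum.cong refl) (simp add: PT)
  \<comment> \<open>Adding the nonnegative term at \<open>t = 0\<close> makes the sum complete,
    ready for Parseval.\<close>
  also have "\<dots> \<le> (\<Sum>t\<in>UNIV. (cmod (\<Sum>r\<in>UNIV. P r * \<psi> (t * r)))\<^sup>2)"
    by (intro sum_mono2) auto
  also have "\<dots> = real CARD('a) * (\<Sum>r\<in>UNIV. (cmod (P r))\<^sup>2)"
    by (rule parseval)
  also have "\<dots> \<le> (\<Sum>r\<in>UNIV. 3 * real CARD('a) ^ (2 * h) * card A * (\<Sum>m | qnorm m = r. (cmod (fB m))\<^sup>2))"
    unfolding sum_distrib_left[of _ _ UNIV]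
  proof (intro sum_mono)
    fix r
    have "(cmod (P r))\<^sup>2 \<le> (\<Sum>m | qnorm m = r. (cmod (fA m))\<^sup>2) * (\<Sum>m | qnorm m = r. (cmod (fB m))\<^sup>2)"
      unfolding P_def using cmod_sum_mult_squared_le[of fA "\<lambda>m. cnj (fB m)"] by simp
    hence "real CARD('a) * (cmod (P r))\<^sup>2
        \<le> real CARD('a) * (\<Sum>m | qnorm m = r. (cmod (fA m))\<^sup>2) * (\<Sum>m | qnorm m = r. (cmod (fB m))\<^sup>2)"
      unfolding mult.assoc by (intro mult_left_mono) auto
    also have "\<dots> \<le> 3 * real CARD('a) ^ (2 * h) * card A * (\<Sum>m | qnorm m = r. (cmod (fB m))\<^sup>2)"
      unfolding fA_def by (intro mult_right_mono sphere_energy_le[OF A small] sum_nonneg) auto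
    finally show "real CARD('a) * (cmod (P r))\<^sup>2
        \<le> 3 * real CARD('a) ^ (2 * h) * card A * (\<Sum>m | qnorm m = r. (cmod (fB m))\<^sup>2)" .
  qed
  also have "\<dots> = 3 * real CARD('a) ^ (2 * h) * card A * (\<Sum>m\<in>UNIV. (cmod (fB m))\<^sup>2)"
    unfolding sum_distrib_left[symmetric]
    using sum.group[of UNIV UNIV qnorm "\<lambda>m. (cmod (fB m))\<^sup>2"] by simp
  also have "(\<Sum>m\<in>UNIV. (cmod (fB m))\<^sup>2) = real CARD('a) ^ (2 * h) * card B"
    unfolding fB_def parseval_dot dimension ..
  finally have "real CARD('a) ^ (2 * h) * energy A B
      \<le> real CARD('a) ^ (2 * h) * (3 * real CARD('a) ^ (2 * h) * card A * card B)"
    by (simp only: mult_ac)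
  thus ?thesis using q_ge_1 by simp
qed

text \<open>For isotropic \<open>a\<close> the phase is linear in \<open>a\<close>, so
  Cauchy-Schwarz in \<open>a\<close> and completion to the cone lead to a second moment. Summing
  over \<open>s\<close> before estimating keeps the bound free of an extra factor q.\<close>

lemma energy_le_large:
  fixes A B :: "('a ^ 'n) set"
  assumes A: "A \<subseteq> sphere0"
  shows "energy A B \<le> card A * (real CARD('a) ^ (2 * h) * card B + real CARD('a) ^ h * (real (card B))\<^sup>2)"
proof -
  define S where "S s x = (\<Sum>b\<in>B. \<psi> (s * qnorm b) * \<psi> (dot x ((- (2 * s)) *s b)))" for s x
  define g :: "'a ^ 'n \<Rightarrow> 'a ^ 'n \<Rightarrow> real" where
    "g b b' = (real CARD('a) ^ (2 * h) * of_bool (b = b')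
        - real CARD('a) ^ h * (real CARD('a) * of_bool (qnorm (b - b') = 0) - 1))
      * (real CARD('a) * of_bool (qnorm b = qnorm b') - 1)" for b b'
  \<comment> \<open>Off the diagonal, \<open>g b b'\<close> is positive only if exactly one of
    \<open>qnorm (b - b') = 0\<close> and \<open>qnorm b = qnorm b'\<close> holds, and then it is
    \<open>q ^ h * (q - 1)\<close>.\<close>
  have g_le: "g b b' \<le> real CARD('a) * (real CARD('a) ^ (2 * h) * of_bool (b = b') + real CARD('a) ^ h)" for b b'
  proof -
    define M Q where "M = real CARD('a) ^ (2 * h)" and "Q = real CARD('a) ^ h"
    have le: "x \<le> real CARD('a) * x" if "0 \<le> x" for x
      using mult_right_mono[OF q_ge_1 that] by simp
    have MQ: "0 \<le> M" "0 \<le> Q" "Q \<le> real CARD('a) * Q"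
      "real CARD('a) * Q \<le> real CARD('a) * (real CARD('a) * Q)"
      by (simp_all add: M_def Q_def le)
    show ?thesis
      unfolding g_def M_def[symmetric] Q_def[symmetric] of_bool_def
      by (simp add: algebra_simps MQ(1,2)) (intro conjI impI; insert MQ; simp only: mult_ac; linarith)
  qed
  have T_le: "(cmod (\<Sum>a\<in>A. \<Sum>b\<in>B. \<psi> (s * qnorm (a - b))))\<^sup>2 \<le> card A * (\<Sum>x\<in>sphere0. (cmod (S s x))\<^sup>2)" for s
  proof -
    have "(\<Sum>a\<in>A. \<Sum>b\<in>B. \<psi> (s * qnorm (a - b))) = (\<Sum>a\<in>A. S s a)"
      unfolding S_def
    proof (intro sum.cong refl)
      fix a b assume "a \<in> A"
      hence "qnorm a = 0" using A by (auto simp: sphere0_def)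
      thus "\<psi> (s * qnorm (a - b)) = \<psi> (s * qnorm b) * \<psi> (dot a ((- (2 * s)) *s b))"
        unfolding add[symmetric] qnorm_diff dot_scale_right by (simp add: algebra_simps)
    qed
    hence "(cmod (\<Sum>a\<in>A. \<Sum>b\<in>B. \<psi> (s * qnorm (a - b))))\<^sup>2 \<le> card A * (\<Sum>x\<in>A. (cmod (S s x))\<^sup>2)"
      using cmod_sum_squared_le by simp
    also have "\<dots> \<le> card A * (\<Sum>x\<in>sphere0. (cmod (S s x))\<^sup>2)"
      using A by (intro mult_left_mono sum_mono2) auto
    finally show ?thesis .
  qed
  have "complex_of_real (real CARD('a) * (\<Sum>s\<in>UNIV - {0}. \<Sum>x\<in>sphere0. (cmod (S s x))\<^sup>2))
      = (\<Sum>s\<in>UNIV - {0}. complex_of_real (real CARD('a) * (\<Sum>x\<in>sphere0. (cmod (S s x))\<^sup>2)))"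
    by (simp only: sum_distrib_left of_real_sum)
  also have "\<dots> = (\<Sum>s\<in>UNIV - {0}. \<Sum>b\<in>B. \<Sum>b'\<in>B.
      (of_nat CARD('a) ^ (2 * h) * of_bool (b = b')
          - of_nat CARD('a) ^ h * (of_nat CARD('a) * of_bool (qnorm (b - b') = 0) - 1))
        * \<psi> ((qnorm b - qnorm b') * s))"
    unfolding S_def cone_second_moment
  proof (intro sum.cong refl)
    fix s :: 'a and b b' assume s: "s \<in> UNIV - {0}"
    \<comment> \<open>Scaling by a nonzero factor preserves coincidence and isotropy, so
      \<open>s\<close> enters only through the phase.\<close>
    have "(- (2 * s)) *s b = (- (2 * s)) *s b' \<longleftrightarrow> b = b'"
      using s by (simp add: vec_eq_iff)
    moreover have "qnorm ((- (2 * s)) *s b - (- (2 * s)) *s b') = 0 \<longleftrightarrow> qnorm (b - b') = 0"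
      unfolding vector_ssub_ldistrib[symmetric] qnorm_scale using s by simp
    moreover have "\<psi> (s * qnorm b) * cnj (\<psi> (s * qnorm b')) = \<psi> ((qnorm b - qnorm b') * s)"
      unfolding diff[symmetric] by (simp add: algebra_simps)
    ultimately show "\<psi> (s * qnorm b) * cnj (\<psi> (s * qnorm b')) *
          (of_nat CARD('a) ^ (2 * h) * of_bool ((- (2 * s)) *s b = (- (2 * s)) *s b')
            - of_nat CARD('a) ^ h * (of_nat CARD('a) * of_bool (qnorm ((- (2 * s)) *s b - (- (2 * s)) *s b') = 0) - 1))
        = (of_nat CARD('a) ^ (2 * h) * of_bool (b = b')
            - of_nat CARD('a) ^ h * (of_nat CARD('a) * of_bool (qnorm (b - b') = 0) - 1))
          * \<psi> ((qnorm b - qnorm b') * s)"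
      by (simp only: mult.commute)
  qed
  also have "\<dots> = (\<Sum>b\<in>B. \<Sum>b'\<in>B. \<Sum>s\<in>UNIV - {0}.
      (of_nat CARD('a) ^ (2 * h) * of_bool (b = b')
          - of_nat CARD('a) ^ h * (of_nat CARD('a) * of_bool (qnorm (b - b') = 0) - 1))
        * \<psi> ((qnorm b - qnorm b') * s))"
    by (subst sum.swap, intro sum.cong refl sum.swap)
  also have "\<dots> = complex_of_real (\<Sum>b\<in>B. \<Sum>b'\<in>B. g b b')"
    unfolding sum_distrib_left[symmetric] orthogonality_nz g_def of_real_sum
    by (intro sum.cong refl) simp
  finally have "real CARD('a) * (\<Sum>s\<in>UNIV - {0}. \<Sum>x\<in>sphere0. (cmod (S s x))\<^sup>2)
      = (\<Sum>b\<in>B. \<Sum>b'\<in>B. g b b')"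
    by (simp only: of_real_eq_iff)
  also have "\<dots> \<le> (\<Sum>b\<in>B. \<Sum>b'\<in>B. real CARD('a) * (real CARD('a) ^ (2 * h) * of_bool (b = b') + real CARD('a) ^ h))"
    by (intro sum_mono g_le)
  also have "\<dots> = real CARD('a) * (real CARD('a) ^ (2 * h) * card B + real CARD('a) ^ h * (real (card B))\<^sup>2)"
    by (simp add: sum.distrib power2_eq_square algebra_simps flip: sum_distrib_left)
  finally have "(\<Sum>s\<in>UNIV - {0}. \<Sum>x\<in>sphere0. (cmod (S s x))\<^sup>2)
      \<le> real CARD('a) ^ (2 * h) * card B + real CARD('a) ^ h * (real (card B))\<^sup>2"
    using q_ge_1 by simp
  hence "card A * (\<Sum>s\<in>UNIV - {0}. \<Sum>x\<in>sphere0. (cmod (S s x))\<^sup>2)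
      \<le> card A * (real CARD('a) ^ (2 * h) * card B + real CARD('a) ^ h * (real (card B))\<^sup>2)"
    by (intro mult_left_mono) auto
  moreover have "energy A B \<le> card A * (\<Sum>s\<in>UNIV - {0}. \<Sum>x\<in>sphere0. (cmod (S s x))\<^sup>2)"
    unfolding energy_def sum_distrib_left[of "real (card A)"] by (intro sum_mono) (simp add: T_le flip: sum_distrib_left)
  ultimately show ?thesis by linarith
qed

section \<open>From energy to the number of distances\<close>

text \<open>Let \<open>\<nu> r\<close> count pairs at distance \<open>r\<close>. Parseval expresses
  its second moment by the energy, and Cauchy-Schwarz on its support compares that with the total
  number of pairs.\<close>

lemma card_dist_set_energy:
  fixes A B :: "('a ^ 'n) set"
  shows "real CARD('a) * (real (card A) * real (card B))\<^sup>2
    \<le> real (card (dist_set A B)) * ((real (card A) * real (card B))\<^sup>2 + energy A B)"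
proof -
  define \<nu> where "\<nu> r = card {i \<in> A \<times> B. qnorm (fst i - snd i) = r}" for r
  have pairs: "(\<Sum>a\<in>A. \<Sum>b\<in>B. \<psi> (s * qnorm (a - b))) = (\<Sum>r\<in>UNIV. complex_of_real (real (\<nu> r)) * \<psi> (s * r))" for s
    using sum_over_fibres[of "A \<times> B" "\<lambda>r. \<psi> (s * r)" "\<lambda>i. qnorm (fst i - snd i)"]
    by (simp add: sum.cartesian_product case_prod_beta \<nu>_def)
  have "real CARD('a) * (\<Sum>r\<in>UNIV. (real (\<nu> r))\<^sup>2)
      = (\<Sum>s\<in>UNIV. (cmod (\<Sum>a\<in>A. \<Sum>b\<in>B. \<psi> (s * qnorm (a - b))))\<^sup>2)"
    unfolding pairs parseval by simp
  also have "\<dots> = (real (card A) * real (card B))\<^sup>2 + energy A B"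
    by (subst sum.remove[of _ 0]) (auto simp: energy_def norm_mult)
  finally have moment: "real CARD('a) * (\<Sum>r\<in>UNIV. (real (\<nu> r))\<^sup>2)
      = (real (card A) * real (card B))\<^sup>2 + energy A B" .
  have "real (card A) * real (card B) = (\<Sum>r\<in>UNIV. real (\<nu> r))"
    using sum_over_fibres[of "A \<times> B" "\<lambda>_. 1 :: real" "\<lambda>i. qnorm (fst i - snd i)"]
    by (simp add: \<nu>_def card_cartesian_product)
  also have "\<dots> = (\<Sum>r\<in>dist_set A B. real (\<nu> r))"
  proof (rule sum.mono_neutral_right)
    show "\<forall>r\<in>UNIV - dist_set A B. real (\<nu> r) = 0"
      by (force simp: \<nu>_def dist_set_def)
  qed auto
  finally have "(real (card A) * real (card B))\<^sup>2 = (\<Sum>r\<in>dist_set A B. 1 * real (\<nu> r))\<^sup>2"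
    by simp
  also have "\<dots> \<le> (\<Sum>r\<in>dist_set A B. 1\<^sup>2) * (\<Sum>r\<in>dist_set A B. (real (\<nu> r))\<^sup>2)"
    by (rule Cauchy_Schwarz_ineq_sum)
  also have "\<dots> \<le> real (card (dist_set A B)) * (\<Sum>r\<in>UNIV. (real (\<nu> r))\<^sup>2)"
    by (simp add: mult_left_mono sum_mono2)
  finally have "real CARD('a) * (real (card A) * real (card B))\<^sup>2
      \<le> real CARD('a) * (real (card (dist_set A B)) * (\<Sum>r\<in>UNIV. (real (\<nu> r))\<^sup>2))"
    by (intro mult_left_mono) auto
  also have "\<dots> = real (card (dist_set A B)) * ((real (card A) * real (card B))\<^sup>2 + energy A B)"
    unfolding moment[symmetric] by simp
  finally show ?thesis .
qed

text \<open>With N the number of pairs, the size condition makes \<open>q ^ (2 * h) * N\<close> at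
  most N^2 / 16. Splitting at \<open>card A = q ^ h\<close> bounds the energy by 3 N^2, so the
  second moment costs a factor 4.\<close>

lemma card_dist_set_ge:
  fixes A B :: "('a ^ 'n) set"
  assumes A: "A \<subseteq> sphere0"
    and size: "real (card A) * real (card B) \<ge> 16 * real CARD('a) ^ (2 * h)"
  shows "real (card (dist_set A B)) \<ge> real CARD('a) / 4"
proof -
  define N where "N = real (card A) * real (card B)"
  have Q: "real CARD('a) ^ (2 * h) \<ge> 1" using q_ge_1 by simp
  have N: "N > 0" using size Q unfolding N_def by linarith
  have main: "real CARD('a) ^ (2 * h) * N \<le> N\<^sup>2 / 16"
    using mult_right_mono[OF size, of N] N by (simp add: N_def power2_eq_square)
  have "energy A B \<le> 3 * N\<^sup>2"
  proof (cases "real (card A) \<le> real CARD('a) ^ h")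
    case True
    have "energy A B \<le> 3 * (real CARD('a) ^ (2 * h) * N)"
      using energy_le_small[OF A True, of B] by (simp add: N_def mult_ac)
    thus ?thesis using main zero_le_power2[of N] by linarith
  next
    case False
    have "card A * (real CARD('a) ^ h * (real (card B))\<^sup>2) = real CARD('a) ^ h * (N * card B)"
      by (simp add: N_def power2_eq_square)
    \<comment> \<open>Here \<open>card A\<close> exceeds \<open>q ^ h\<close> and absorbs it,
      turning the off-diagonal term into N^2.\<close>
    also have "\<dots> \<le> card A * (N * card B)"
      using False N by (intro mult_right_mono) auto
    also have "\<dots> = N\<^sup>2" by (simp add: N_def power2_eq_square)
    finally have "energy A B \<le> real CARD('a) ^ (2 * h) * N + N\<^sup>2"
      using energy_le_large[OF A, of B] by (simp add: N_def algebra_simps)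
    thus ?thesis using main zero_le_power2[of N] by linarith
  qed
  hence "real CARD('a) * N\<^sup>2 \<le> real (card (dist_set A B)) * (4 * N\<^sup>2)"
    using card_dist_set_energy[of A B]
      mult_left_mono[of "N\<^sup>2 + energy A B" "4 * N\<^sup>2" "real (card (dist_set A B))"]
    by (simp add: N_def)
  thus ?thesis using N by simp
qed

end

theorem theorem1p21:
  fixes A B :: "(('a::{field,finite}) ^ 'n) set" and k :: nat
  assumes q_pow: "\<exists>p m. prime p \<and> odd p \<and> m > 0 \<and> CARD('a) = p ^ m"
    and q_mod: "CARD('a) mod 4 = 3"
    and k_pos: "k > 0"
    and d_def: "CARD('n) = 4 * k + 2"
    and A_sub: "A \<subseteq> sphere0"
    and size: "real (card A) * real (card B) \<ge> 16 * real CARD('a) ^ CARD('n)"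
    and A_range: "real (card A) \<le> real CARD('a) powr ((real CARD('n) - 1) / 2)
                  \<or> real (card A) \<ge> real CARD('a) powr (real CARD('n) / 2)"
  shows "real (card (dist_set A B)) \<ge> real CARD('a) / 144"
proof -
  obtain \<psi> :: "'a \<Rightarrow> complex" where "additive_character \<psi>"
    using additive_character_exists by blast
  \<comment> \<open>Half of \<open>4 * k + 2\<close> is \<open>2 * k + 1\<close>, which is
    odd.\<close>
  then interpret gauss_space \<psi> "TYPE('n)" "2 * k + 1"
    using q_mod d_def by (simp add: gauss_space_def gauss_space_axioms_def)
  have "2 * (2 * k + 1) = CARD('n)" using d_def by simp
  hence "real CARD('a) / 4 \<le> real (card (dist_set A B))"
    using card_dist_set_ge[OF A_sub, of B] size by simp
  \<comment> \<open>The constant 1/4 exceeds 1/144.\<close>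
  thus ?thesis by simp
qed

end
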